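(* Let $R$ be a Lie conformal superalgebra with center $Z(R)$. If $Z(R)=0$, then $\mathrm{QC}(R)\cap\mathrm{QDer}(R)=\mathrm{C}(R)$.
   Context: Everything is over $\mathbb{C}$. Degrees $|a|$ lie in $\mathbb{Z}_2$; whenever $|a|$ occurs, $a$ is homogeneous, and formulas are extended linearly. All $\mathbb{Z}_2$-graded $\mathbb{C}[\partial]$-modules are finitely generated. A Lie conformal superalgebra is a $\mathbb{Z}_2$-graded $\mathbb{C}[\partial]$-module $R=R_{\bar0}\oplus R_{\bar1}$ with a $\mathbb{C}$-bilinear map $R\times R\to R[\lambda]$, $(a,b)\mapsto[a_\lambda b]$, compatible with the grading, such that (C1) $[(\partial a)_\lambda b]=-\lambda[a_\lambda b]$; (C2) $[a_\lambda b]=-(-1)^{|a||b|}[b_{-\partial-\lambda}a]$ (on the right, $\nu=-\partial-\lambda$ is substituted into $[b_\nu a]=\sum_n\nu^nc_n$ with $\partial$ acting on the $c_n$); (C3) $[a_\lambda[b_\mu c]]=[[a_\lambda b]_{\lambda+\mu}c]+(-1)^{|a||b|}[b_\mu[a_\lambda c]]$. Brackets and maps are extended linearly over polynomials in the formal variables. The center is $Z(R)=\{a\in R:[a_\lambda b]=0\ \forall b\in R\}$. $\mathrm{Cend}(R)_\theta$ is the space of conformal linear maps $R\to R$ of degree $\theta$: $\mathbb{C}$-linear $f_\lambda:R\to R[\lambda]$ with $f_\lambda\partial=(\partial+\lambda)f_\lambda$ and $f_\lambda(R_\mu)\subseteq R_{\mu+\theta}[\lambda]$. For $f\in\mathrm{Cend}(R)_\theta$: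 - $f\in\mathrm{QDer}(R)_\theta$ (quasiderivation) if there is $f'\in\mathrm{Cend}(R)_\theta$ with $[(f_\lambda(a))_{\lambda+\mu}b]+(-1)^{\theta|a|}[a_\mu(f_\lambda(b))]=f'_\lambda([a_\mu b])$ for all $a,b\in R$; - $f\in\mathrm{C}(R)_\theta$ (centroid) if $[(f_\lambda(a))_{\lambda+\mu}b]=(-1)^{\theta|a|}[a_\mu(f_\lambda(b))]=f_\lambda([a_\mu b])$ for all $a,b\in R$; - $f\in\mathrm{QC}(R)_\theta$ (quasicentroid) if $[(f_\lambda(a))_{\lambda+\mu}b]=(-1)^{\theta|a|}[a_\mu(f_\lambda(b))]$ for all $a,b\in R$. $\mathrm{QDer}(R)$, $\mathrm{C}(R)$, $\mathrm{QC}(R)$ denote the sums of their degree $\bar0$ and degree $\bar1$ parts. *)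

theory Defs
  imports "HOL-Computational_Algebra.Polynomial" "HOL-Library.Z2" Complex_Main
begin

text \<open>
  A \<open>\<complex>[\<partial>]\<close>-module is a module (in the sense of the locale \<^locale>\<open>module\<close>) over the ring
  \<^typ>\<open>complex poly\<close>; \<open>\<partial>\<close> and the complex scalars are recovered as the actions of \<open>[:0, 1:]\<close>
  and of the constant polynomials.  Degrees are elements of the two-element field \<^typ>\<open>bit\<close>.
  The space \<open>R[\<lambda>]\<close> is \<^typ>\<open>'r poly\<close>.
\<close>

definition partial :: "(complex poly \<Rightarrow> 'r \<Rightarrow> 'r) \<Rightarrow> 'r \<Rightarrow> 'r" where
  "partial act = act [:0, 1:]"

definition cscale :: "(complex poly \<Rightarrow> 'r \<Rightarrow> 'r) \<Rightarrow> complex \<Rightarrow> 'r \<Rightarrow> 'r" where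
  "cscale act c = act [:c:]"

definition pscale :: "(complex poly \<Rightarrow> 'r::zero \<Rightarrow> 'r) \<Rightarrow> complex \<Rightarrow> 'r poly \<Rightarrow> 'r poly" where
  "pscale act c = map_poly (cscale act c)"

lemma vector_space_cscale:
  assumes "module act"
  shows "vector_space (cscale act)"
proof -
  interpret module act by fact
  show ?thesis
    unfolding vector_space_def cscale_def
    by (auto simp: scale_right_distrib scale_left_distrib[symmetric] one_pCons[symmetric]
        mult.commute)
qed

lemma vector_space_pscale:
  assumes "module act"
  shows "vector_space (pscale act)"
proof -
  interpret vector_space "cscale act" using vector_space_cscale[OF assms] .
  show ?thesis
    unfolding vector_space_def pscale_def
    by (auto simp: poly_eq_iff coeff_map_poly scale_right_distrib scale_left_distrib)
qed

definition polys_in :: "'r::zero set \<Rightarrow> 'r poly set" where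
  "polys_in S = {p. \<forall>n. coeff p n \<in> S}"

text \<open>The Koszul sign \<open>(-1)\<^sup>\<epsilon>\<close> applied to \<open>x\<close>.\<close>

definition signed :: "bit \<Rightarrow> 'm::ab_group_add \<Rightarrow> 'm" where
  "signed \<epsilon> x = (if \<epsilon> = 0 then x else - x)"

text \<open>
  For \<open>p = \<Sum>\<^sub>n \<nu>\<^sup>n c\<^sub>n\<close>, the value \<open>\<Sum>\<^sub>n T\<^sup>n (e c\<^sub>n)\<close>: every coefficient is sent to a module on which
  the operator \<open>T\<close> acts, and \<open>T\<close> is substituted for \<open>\<nu>\<close>.  Taking for \<open>e\<close> a map defined on \<open>R\<close>
  only and for \<open>T\<close> multiplication by a formal variable yields the extension of \<open>e\<close> to
  polynomials, linear over that variable.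
\<close>

definition subst :: "('m \<Rightarrow> 'm) \<Rightarrow> ('r \<Rightarrow> 'm) \<Rightarrow> 'r::zero poly \<Rightarrow> 'm::comm_monoid_add" where
  "subst T e p = (\<Sum>n\<le>degree p. (T ^^ n) (e (coeff p n)))"

text \<open>
  \<open>R[\<lambda>, \<mu>]\<close> is \<^typ>\<open>'r poly poly\<close>: the inner variable is \<open>\<lambda>\<close>, the outer one is \<open>\<mu>\<close>.  The following
  are the multiplications by \<open>\<lambda>\<close>, \<open>\<mu>\<close>, \<open>\<lambda> + \<mu>\<close>, and \<open>at2 T p\<close> is \<open>p(T)\<close> for \<open>T\<close> one of these.
\<close>

definition lam :: "'r::ab_group_add poly poly \<Rightarrow> 'r poly poly" where
  "lam = map_poly (pCons 0)"

definition mu :: "'r::ab_group_add poly poly \<Rightarrow> 'r poly poly" where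
  "mu = pCons 0"

definition lam_mu :: "'r::ab_group_add poly poly \<Rightarrow> 'r poly poly" where
  "lam_mu q = lam q + mu q"

definition at2 :: "('r poly poly \<Rightarrow> 'r poly poly) \<Rightarrow> 'r::ab_group_add poly \<Rightarrow> 'r poly poly" where
  "at2 T = subst T (\<lambda>x. [:[:x:]:])"

text \<open>Multiplication by \<open>- \<partial> - \<lambda>\<close> on \<open>R[\<lambda>]\<close>, with \<open>\<partial>\<close> acting on the coefficients.\<close>

definition neg_partial_lam ::
  "(complex poly \<Rightarrow> 'r \<Rightarrow> 'r) \<Rightarrow> 'r::ab_group_add poly \<Rightarrow> 'r poly" where
  "neg_partial_lam act p = - map_poly (partial act) p - pCons 0 p"

locale z2_graded_module = module act
  for act :: "complex poly \<Rightarrow> 'r::ab_group_add \<Rightarrow> 'r" +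
  fixes G :: "bit \<Rightarrow> 'r set"
  assumes submodule_G: "subspace (G \<alpha>)"
    and G_disjoint: "G 0 \<inter> G 1 = {0}"
    and G_sum: "\<exists>y\<in>G 0. \<exists>z\<in>G 1. x = y + z"
    and finitely_generated: "\<exists>S. finite S \<and> span S = UNIV"

locale lie_conformal_superalgebra = z2_graded_module act G
  for act :: "complex poly \<Rightarrow> 'r::ab_group_add \<Rightarrow> 'r" and G :: "bit \<Rightarrow> 'r set" +
  fixes br :: "'r \<Rightarrow> 'r \<Rightarrow> 'r poly"
  assumes br_linear_left: "Vector_Spaces.linear (cscale act) (pscale act) (\<lambda>a. br a b)"
    and br_linear_right: "Vector_Spaces.linear (cscale act) (pscale act) (br a)"
    and br_graded: "a \<in> G \<alpha> \<Longrightarrow> b \<in> G \<beta> \<Longrightarrow> br a b \<in> polys_in (G (\<alpha> + \<beta>))"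
    and C1: "br (partial act a) b = - pCons 0 (br a b)"
    and C2: "a \<in> G \<alpha> \<Longrightarrow> b \<in> G \<beta> \<Longrightarrow>
      br a b = - signed (\<alpha> * \<beta>) (subst (neg_partial_lam act) (\<lambda>x. [:x:]) (br b a))"
    and C3: "a \<in> G \<alpha> \<Longrightarrow> b \<in> G \<beta> \<Longrightarrow>
      subst mu (\<lambda>x. at2 lam (br a x)) (br b c) =
        subst lam (\<lambda>x. at2 lam_mu (br x c)) (br a b) +
        signed (\<alpha> * \<beta>) (subst lam (\<lambda>x. at2 mu (br b x)) (br a c))"

definition center :: "('r \<Rightarrow> 'r \<Rightarrow> 'r::zero poly) \<Rightarrow> 'r set" where
  "center br = {a. \<forall>b. br a b = 0}"

definition Cend_deg ::
  "(complex poly \<Rightarrow> 'r \<Rightarrow> 'r) \<Rightarrow> (bit \<Rightarrow> 'r set) \<Rightarrow> bit \<Rightarrow> ('r \<Rightarrow> 'r::ab_group_add poly) set" where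
  "Cend_deg act G \<theta> = {f. Vector_Spaces.linear (cscale act) (pscale act) f \<and>
     (\<forall>a. f (partial act a) = map_poly (partial act) (f a) + pCons 0 (f a)) \<and>
     (\<forall>\<alpha>. \<forall>a\<in>G \<alpha>. f a \<in> polys_in (G (\<alpha> + \<theta>)))}"

text \<open>
  For a conformal linear map \<open>f\<close>, the elements
  \<open>[(f\<^sub>\<lambda>(a))\<^sub>\<lambda>\<^sub>+\<^sub>\<mu> b]\<close>, \<open>[a\<^sub>\<mu> (f\<^sub>\<lambda>(b))]\<close> and \<open>f\<^sub>\<lambda>([a\<^sub>\<mu> b])\<close> of \<open>R[\<lambda>, \<mu>]\<close>.
\<close>

definition br_left ::
  "('r \<Rightarrow> 'r \<Rightarrow> 'r poly) \<Rightarrow> ('r \<Rightarrow> 'r poly) \<Rightarrow> 'r \<Rightarrow> 'r \<Rightarrow> 'r::ab_group_add poly poly" where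
  "br_left br f a b = subst lam (\<lambda>x. at2 lam_mu (br x b)) (f a)"

definition br_right ::
  "('r \<Rightarrow> 'r \<Rightarrow> 'r poly) \<Rightarrow> ('r \<Rightarrow> 'r poly) \<Rightarrow> 'r \<Rightarrow> 'r \<Rightarrow> 'r::ab_group_add poly poly" where
  "br_right br f a b = subst lam (\<lambda>x. at2 mu (br a x)) (f b)"

definition of_br ::
  "('r \<Rightarrow> 'r \<Rightarrow> 'r poly) \<Rightarrow> ('r \<Rightarrow> 'r poly) \<Rightarrow> 'r \<Rightarrow> 'r \<Rightarrow> 'r::ab_group_add poly poly" where
  "of_br br f a b = subst mu (\<lambda>x. at2 lam (f x)) (br a b)"

definition QDer_deg ::
  "(complex poly \<Rightarrow> 'r \<Rightarrow> 'r) \<Rightarrow> (bit \<Rightarrow> 'r set) \<Rightarrow> ('r \<Rightarrow> 'r \<Rightarrow> 'r poly) \<Rightarrow> bit \<Rightarrow>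
    ('r \<Rightarrow> 'r::ab_group_add poly) set" where
  "QDer_deg act G br \<theta> = {f \<in> Cend_deg act G \<theta>. \<exists>f'\<in>Cend_deg act G \<theta>.
     \<forall>\<alpha>. \<forall>a\<in>G \<alpha>. \<forall>b.
       br_left br f a b + signed (\<theta> * \<alpha>) (br_right br f a b) = of_br br f' a b}"

definition C_deg ::
  "(complex poly \<Rightarrow> 'r \<Rightarrow> 'r) \<Rightarrow> (bit \<Rightarrow> 'r set) \<Rightarrow> ('r \<Rightarrow> 'r \<Rightarrow> 'r poly) \<Rightarrow> bit \<Rightarrow>
    ('r \<Rightarrow> 'r::ab_group_add poly) set" where
  "C_deg act G br \<theta> = {f \<in> Cend_deg act G \<theta>. \<forall>\<alpha>. \<forall>a\<in>G \<alpha>. \<forall>b.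
       br_left br f a b = signed (\<theta> * \<alpha>) (br_right br f a b) \<and>
       signed (\<theta> * \<alpha>) (br_right br f a b) = of_br br f a b}"

definition QC_deg ::
  "(complex poly \<Rightarrow> 'r \<Rightarrow> 'r) \<Rightarrow> (bit \<Rightarrow> 'r set) \<Rightarrow> ('r \<Rightarrow> 'r \<Rightarrow> 'r poly) \<Rightarrow> bit \<Rightarrow>
    ('r \<Rightarrow> 'r::ab_group_add poly) set" where
  "QC_deg act G br \<theta> = {f \<in> Cend_deg act G \<theta>. \<forall>\<alpha>. \<forall>a\<in>G \<alpha>. \<forall>b.
       br_left br f a b = signed (\<theta> * \<alpha>) (br_right br f a b)}"

definition graded_sum :: "(bit \<Rightarrow> ('r \<Rightarrow> 'm::plus) set) \<Rightarrow> ('r \<Rightarrow> 'm) set" where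
  "graded_sum A = {\<lambda>a. f a + g a | f g. f \<in> A 0 \<and> g \<in> A 1}"

definition QDer ::
  "(complex poly \<Rightarrow> 'r \<Rightarrow> 'r) \<Rightarrow> (bit \<Rightarrow> 'r set) \<Rightarrow> ('r \<Rightarrow> 'r \<Rightarrow> 'r poly) \<Rightarrow>
    ('r \<Rightarrow> 'r::ab_group_add poly) set" where
  "QDer act G br = graded_sum (QDer_deg act G br)"

definition Centroid ::
  "(complex poly \<Rightarrow> 'r \<Rightarrow> 'r) \<Rightarrow> (bit \<Rightarrow> 'r set) \<Rightarrow> ('r \<Rightarrow> 'r \<Rightarrow> 'r poly) \<Rightarrow>
    ('r \<Rightarrow> 'r::ab_group_add poly) set" where
  "Centroid act G br = graded_sum (C_deg act G br)"

definition QC ::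
  "(complex poly \<Rightarrow> 'r \<Rightarrow> 'r) \<Rightarrow> (bit \<Rightarrow> 'r set) \<Rightarrow> ('r \<Rightarrow> 'r \<Rightarrow> 'r poly) \<Rightarrow>
    ('r \<Rightarrow> 'r::ab_group_add poly) set" where
  "QC act G br = graded_sum (QC_deg act G br)"

end

theory Submission imports Defs begin

text \<open>
  Polynomials with coefficients in a complex vector space are determined by their values at complex
  numbers, so the formal variables may be replaced by numbers throughout.  If \<open>f\<close> is a quasicentroid
  element and a quasiderivation with companion \<open>f'\<close>, put \<open>h = f'/2 - f\<close>.  The Jacobi identity gives
  \<open>[a, h[b, c]] = \<plusminus> [h[a, b], c]\<close>, which skew-symmetry turns into \<open>\<mp> [c, h[a, b]]\<close>.  Rotating
  \<open>a, b, c\<close> three times gives \<open>[a, h[b, c]] = - [a, h[b, c]]\<close>, and since the center vanishes \<open>h\<close> is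
  zero on brackets.  Skew-symmetry needs \<open>-\<partial> - \<lambda>\<close> in place of a variable; bracketing everything with
  one more element, which is harmless because the center is zero, makes \<open>\<partial>\<close> a number as well.
\<close>

text \<open>Degrees keep their ring form instead of turning into bit operations, so that ring laws
  such as \<open>distrib_left\<close> and \<open>add_ac\<close> apply to sign exponents.\<close>

declare add_bit_eq_xor [simp del] mult_bit_eq_and [simp del]

section \<open>Substituting an operator for a formal variable\<close>

lemma additive_funpow:
  fixes T :: "'a::ab_group_add \<Rightarrow> 'a"
  shows "additive T \<Longrightarrow> additive (T ^^ n)"
  by (induction n) (auto simp: additive_def)

text \<open>Terms beyond the degree vanish because \<open>e\<close> and the powers of
  \<open>T\<close> send 0 to 0. Polynomials of different degrees can thus be summed over a common
  range.\<close>

lemma subst_eq_sum: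
  assumes "additive T" "additive e" "degree p \<le> N"
  shows "subst T e p = (\<Sum>n\<le>N. (T ^^ n) (e (coeff p n)))"
proof -
  have "(T ^^ n) (e (coeff p n)) = 0" if "n > degree p" for n
    using that additive.zero[OF assms(2)] additive.zero[OF additive_funpow[OF assms(1)], of n]
    by (simp add: coeff_eq_0)
  then show ?thesis
    unfolding subst_def using assms(3) by (intro sum.mono_neutral_left) auto
qed

lemma additive_subst:
  fixes e :: "'r::ab_group_add \<Rightarrow> 'm::ab_group_add"
  assumes T: "additive T" and e: "additive e"
  shows "additive (subst T e)"
proof
  fix p q :: "'r poly"
  define N where "N = max (degree p) (degree q)"
  have N: "degree p \<le> N" "degree q \<le> N" "degree (p + q) \<le> N"
    unfolding N_def by (auto intro: degree_add_le)
  show "subst T e (p + q) = subst T e p + subst T e q"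
    unfolding subst_eq_sum[OF T e N(1)] subst_eq_sum[OF T e N(2)] subst_eq_sum[OF T e N(3)]
    by (simp add: additive.add[OF e] additive.add[OF additive_funpow[OF T]] sum.distrib)
qed

text \<open>\<open>\<phi>\<close> intertwines \<open>T\<close> with \<open>T'\<close>, hence also
  their powers. Instances of this turn multiplication by \<lambda>, \<mu>, \<lambda> + \<mu> or
  -\<partial> - \<lambda> into multiplication by a number.\<close>

lemma additive_apply_subst:
  assumes \<phi>: "additive \<phi>" and comm: "\<And>x. \<phi> (T x) = T' (\<phi> x)"
  shows "\<phi> (subst T e p) = subst T' (\<lambda>x. \<phi> (e x)) p"
proof -
  have "\<phi> ((T ^^ n) x) = (T' ^^ n) (\<phi> x)" for n x
    by (induction n) (auto simp: comm)
  then show ?thesis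
    unfolding subst_def by (simp add: additive.sum[OF \<phi>])
qed

lemma subst_pCons:
  assumes T: "additive T" and e: "additive e"
  shows "subst T e (pCons a p) = e a + T (subst T e p)"
proof -
  have "degree (pCons a p) \<le> Suc (degree p)" by (rule degree_pCons_le)
  note * = subst_eq_sum[OF T e this]
  show ?thesis
    unfolding * sum.atMost_Suc_shift unfolding subst_def
    by (simp add: additive.sum[OF T])
qed

lemma subst_map_poly:
  assumes "additive T" "additive e" "additive g"
  shows "subst T e (map_poly g p) = subst T (\<lambda>x. e (g x)) p"
proof -
  have eg: "additive (\<lambda>x. e (g x))" using assms(2,3) by (simp add: additive_def)
  have g0: "g 0 = 0" by (rule additive.zero[OF assms(3)])
  have "degree (map_poly g p) \<le> degree p" by (rule degree_le) (simp add: coeff_map_poly g0 coeff_eq_0)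
  then show ?thesis
    by (simp add: subst_eq_sum[OF assms(1,2)] subst_eq_sum[OF assms(1) eg order_refl] coeff_map_poly g0)
qed

lemma signed_signed [simp]: "signed \<alpha> (signed \<beta> x) = signed (\<alpha> + \<beta>) x"
  by (cases \<alpha>; cases \<beta>) (auto simp: signed_def)

lemma additive_signed: "additive f \<Longrightarrow> f (signed \<epsilon> x) = signed \<epsilon> (f x)"
  by (simp add: signed_def additive.minus)

lemma signed_add: "signed \<epsilon> (x + y) = signed \<epsilon> x + signed \<epsilon> y"
  and signed_minus: "signed \<epsilon> (- x) = - signed \<epsilon> x"
  and signed_0 [simp]: "signed 0 x = x"
  by (auto simp: signed_def)

text \<open>In place of a Vandermonde determinant, the scaling of z by 2 separates the monomials:
  injectivity of \<open>of_nat\<close> makes the powers of 2 distinct.\<close>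

lemma (in vector_space) coeffs_zero_if_polynomial_vanishes:
  fixes c :: "nat \<Rightarrow> 'b"
  assumes "inj (of_nat :: nat \<Rightarrow> 'a)"
    and "\<And>z. (\<Sum>k\<le>n. (z ^ k) *s c k) = 0" and "k \<le> n"
  shows "c k = 0"
  using assms(2,3)
proof (induction n arbitrary: c k)
  case 0
  from "0.prems"(1)[of 0] "0.prems"(2) show ?case by simp
next
  case (Suc n)
  have two: "(2::'a) ^ i \<noteq> 2 ^ j" if "i < j" for i j
  proof -
    have "(of_nat (2 ^ i) :: 'a) \<noteq> of_nat (2 ^ j)"
      using that inj_eq[OF assms(1)] by (metis less_irrefl one_less_numeral_iff
          power_strict_increasing_iff semiring_norm(76))
    then show ?thesis by simp
  qed
  \<comment> \<open>The combination \<open>p(2 z) - 2^(n + 1) p(z)\<close> of values of \<open>p\<close> has no leading term.\<close>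
  have low: "c i = 0" if "i \<le> n" for i
  proof -
    have "(\<Sum>i\<le>n. (z ^ i) *s ((2 ^ i - 2 ^ Suc n) *s c i)) = 0" for z
    proof -
      have "0 = (\<Sum>i\<le>Suc n. ((2 * z) ^ i) *s c i) - (2 ^ Suc n) *s (\<Sum>i\<le>Suc n. (z ^ i) *s c i)"
        using Suc.prems(1)[of z] Suc.prems(1)[of "2 * z"] by simp
      also have "\<dots> = (\<Sum>i\<le>Suc n. (z ^ i) *s ((2 ^ i - 2 ^ Suc n) *s c i))"
      proof -
        have "(2 * z) ^ i - 2 ^ Suc n * z ^ i = z ^ i * (2 ^ i - 2 ^ Suc n)" for i
          by (simp only: power_mult_distrib right_diff_distrib mult.commute)
        then show ?thesis
          by (simp only: scale_sum_right sum_subtractf[symmetric] scale_scale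
              scale_left_diff_distrib[symmetric])
      qed
      finally show ?thesis by simp
    qed
    from Suc.IH[OF this that] have "(2 ^ i - 2 ^ Suc n) *s c i = 0" .
    with two[of i "Suc n"] that show ?thesis by (simp del: power_Suc)
  qed
  show ?case
  proof (cases "k = Suc n")
    case True
    \<comment> \<open>With the lower coefficients gone, the value at 1 is the leading
      coefficient.\<close>
    then show ?thesis using Suc.prems(1)[of 1] low by simp
  next
    case False
    then show ?thesis using low Suc.prems(2) by simp
  qed
qed

section \<open>Evaluating formal variables at complex numbers\<close>

definition ev :: "(complex poly \<Rightarrow> 'r \<Rightarrow> 'r) \<Rightarrow> complex \<Rightarrow> 'r::ab_group_add poly \<Rightarrow> 'r" where
  "ev act z = subst (cscale act z) (\<lambda>x. x)"

text \<open>\<open>ev2 act l m\<close> substitutes \<open>\<lambda> = l\<close> and \<open>\<mu> = m\<close>.\<close>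

definition ev2 ::
  "(complex poly \<Rightarrow> 'r \<Rightarrow> 'r) \<Rightarrow> complex \<Rightarrow> complex \<Rightarrow> 'r::ab_group_add poly poly \<Rightarrow> 'r" where
  "ev2 act l m = subst (cscale act m) (ev act l)"

context z2_graded_module
begin

interpretation V: vector_space "cscale act"
  by (rule vector_space_cscale) unfold_locales

lemma cscale_commute: "cscale act z (cscale act w x) = cscale act w (cscale act z x)"
  by (simp add: mult.commute)

lemma additive_cscale: "additive (cscale act z)"
  by (simp add: additive_def V.scale_right_distrib)

lemma additive_id: "additive (\<lambda>x. x)"
  by (simp add: additive_def)

lemma cscale_subst:
  "cscale act w (subst (cscale act z) e p) = subst (cscale act z) (\<lambda>x. cscale act w (e x)) p"
  by (rule additive_apply_subst[where \<phi> = "cscale act w"], rule additive_cscale, rule cscale_commute)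

lemma additive_partial: "additive (partial act)"
  by (simp add: additive_def partial_def scale_right_distrib)

lemma partial_cscale: "partial act (cscale act z x) = cscale act z (partial act x)"
  by (simp add: partial_def cscale_def)

lemma additive_ev: "additive (ev act z)"
  unfolding ev_def by (intro additive_subst additive_cscale additive_id)

lemma additive_ev2: "additive (ev2 act l m)"
  unfolding ev2_def by (intro additive_subst additive_cscale additive_ev)

lemma ev_const: "ev act z [:x:] = x"
  unfolding ev_def
  by (simp add: subst_pCons additive_cscale additive_id additive.zero[OF additive_cscale]
      additive.zero[OF additive_subst])

lemma ev_pCons: "ev act z (pCons a p) = a + cscale act z (ev act z p)"
  unfolding ev_def by (simp add: subst_pCons additive_cscale additive_id)

lemma ev2_pCons: "ev2 act l m (pCons p P) = ev act l p + cscale act m (ev2 act l m P)"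
  unfolding ev2_def by (simp add: subst_pCons additive_cscale additive_ev)

lemma ev2_const: "ev2 act l m [:[:x:]:] = x"
  by (simp add: ev2_pCons ev_const additive.zero[OF additive_ev2])

lemma ev_partial: "ev act z (map_poly (partial act) p) = partial act (ev act z p)"
  unfolding ev_def
  by (subst additive_apply_subst[where \<phi> = "partial act" and T = "cscale act z" and T' = "cscale act z"])
    (simp_all add: additive_partial partial_cscale subst_map_poly additive_cscale additive_id)

lemma ev_pscale: "ev act z (pscale act w p) = cscale act w (ev act z p)"
  unfolding ev_def pscale_def
  by (subst cscale_subst)
    (simp add: subst_map_poly additive_cscale additive_id)

lemma ev2_mu: "ev2 act l m (mu P) = cscale act m (ev2 act l m P)"
  by (simp add: mu_def ev2_pCons additive.zero[OF additive_ev])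

lemma ev2_lam: "ev2 act l m (lam P) = cscale act l (ev2 act l m P)"
proof -
  have "additive (pCons (0::'r))" by (simp add: additive_def)
  then show ?thesis unfolding ev2_def lam_def
    by (subst cscale_subst)
      (simp add: subst_map_poly additive_cscale additive_ev ev_pCons)
qed

lemma ev2_lam_mu: "ev2 act l m (lam_mu P) = cscale act (l + m) (ev2 act l m P)"
  by (simp add: lam_mu_def additive.add[OF additive_ev2] ev2_lam ev2_mu V.scale_left_distrib)

lemma ev2_subst:
  shows "ev2 act l m (subst mu e p) = subst (cscale act m) (\<lambda>x. ev2 act l m (e x)) p"
    and "ev2 act l m (subst lam e p) = subst (cscale act l) (\<lambda>x. ev2 act l m (e x)) p"
    and "ev2 act l m (subst lam_mu e p) = subst (cscale act (l + m)) (\<lambda>x. ev2 act l m (e x)) p"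
  by (rule additive_apply_subst[where \<phi> = "ev2 act l m"];
      simp add: additive_ev2 ev2_mu ev2_lam ev2_lam_mu)+

lemma ev2_at2:
  shows "ev2 act l m (at2 mu p) = ev act m p"
    and "ev2 act l m (at2 lam p) = ev act l p"
    and "ev2 act l m (at2 lam_mu p) = ev act (l + m) p"
  unfolding at2_def ev_def
  by (simp_all add: ev2_subst ev2_const)

lemma linear_ev:
  assumes "Vector_Spaces.linear (cscale act) (pscale act) f"
  shows "additive (\<lambda>x. ev act l (f x))"
    and "ev act l (f (cscale act z x)) = cscale act z (ev act l (f x))"
proof -
  interpret f: Vector_Spaces.linear "cscale act" "pscale act" f by fact
  show "additive (\<lambda>x. ev act l (f x))"
    by (simp add: additive_def f.add additive.add[OF additive_ev])
  show "ev act l (f (cscale act z x)) = cscale act z (ev act l (f x))"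
    by (simp add: f.scale ev_pscale)
qed

text \<open>\<open>f\<close> followed by evaluation commutes with numerical scalars, so it can be
  pulled out of the sum over the coefficients of \<open>p\<close>.\<close>

lemma linear_ev_ev:
  assumes "Vector_Spaces.linear (cscale act) (pscale act) f"
  shows "subst (cscale act m) (\<lambda>x. ev act l (f x)) p = ev act l (f (ev act m p))"
  unfolding ev_def[of act m]
  by (rule additive_apply_subst[where \<phi> = "\<lambda>x. ev act l (f x)" and T = "cscale act m", symmetric])
    (rule linear_ev[OF assms])+

text \<open>These are the three nested shapes that occur in \<open>C3\<close> and in
  \<open>of_br\<close>, \<open>br_right\<close> and \<open>br_left\<close>, so all identities in two
  variables become identities in R.\<close>

lemma ev2_subst_linear:
  assumes "Vector_Spaces.linear (cscale act) (pscale act) f"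
  shows "ev2 act l m (subst mu (\<lambda>x. at2 lam (f x)) p) = ev act l (f (ev act m p))"
    and "ev2 act l m (subst lam (\<lambda>x. at2 mu (f x)) p) = ev act m (f (ev act l p))"
    and "ev2 act l m (subst lam (\<lambda>x. at2 lam_mu (f x)) p) = ev act (l + m) (f (ev act l p))"
  unfolding ev2_subst ev2_at2 by (rule linear_ev_ev[OF assms])+

lemma poly_eqI_ev:
  assumes "\<And>z. ev act z p = ev act z q"
  shows "p = q"
proof -
  have pow: "(cscale act z ^^ k) x = cscale act (z ^ k) x" for z k x
    by (induction k) auto
  have "coeff (p - q) k = 0" for k
  proof (cases "k \<le> degree (p - q)")
    case True
    have "(\<Sum>k\<le>degree (p - q). cscale act (z ^ k) (coeff (p - q) k)) = 0" for z
      using assms[of z] additive.diff[OF additive_ev, of z p q]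
      by (simp add: ev_def subst_def pow)
    from V.coeffs_zero_if_polynomial_vanishes[OF inj_of_nat this True] show ?thesis .
  qed (simp add: coeff_eq_0 del: coeff_diff)
  then show ?thesis by (metis eq_iff_diff_eq_0 poly_eq_iff coeff_0)
qed

lemma ev_map_poly_ev: "ev act m (map_poly (ev act l) P) = ev2 act l m P"
  unfolding ev2_def unfolding ev_def[of act m]
  by (simp add: subst_map_poly additive_cscale additive_id additive_ev)

text \<open>One variable at a time: varying \<open>m\<close> for fixed \<open>l\<close> shows that
  the coefficients agree at \<open>l\<close>, and varying \<open>l\<close> then shows that they are
  equal.\<close>

lemma poly_poly_eqI_ev2:
  assumes "\<And>l m. ev2 act l m P = ev2 act l m Q"
  shows "P = Q"
proof -
  have "map_poly (ev act l) P = map_poly (ev act l) Q" for l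
    by (rule poly_eqI_ev) (simp add: ev_map_poly_ev assms)
  then have "ev act l (coeff P n) = ev act l (coeff Q n)" for l n
    by (metis coeff_map_poly additive.zero[OF additive_ev])
  then show ?thesis
    by (intro poly_eqI poly_eqI_ev)
qed

section \<open>Homogeneous components\<close>

lemma cscale_in_G: "x \<in> G \<alpha> \<Longrightarrow> cscale act z x \<in> G \<alpha>"
  unfolding cscale_def by (rule subspace_scale[OF submodule_G])

lemma ev_in_G:
  assumes "p \<in> polys_in (G \<alpha>)"
  shows "ev act z p \<in> G \<alpha>"
proof -
  have "(cscale act z ^^ n) x \<in> G \<alpha>" if "x \<in> G \<alpha>" for n x
    using that by (induction n) (auto intro: cscale_in_G)
  with assms show ?thesis
    unfolding ev_def subst_def polys_in_def by (auto intro!: subspace_sum[OF submodule_G])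
qed

lemma eq_if_eq_on_G:
  assumes "additive f" "additive g" "\<And>\<alpha> x. x \<in> G \<alpha> \<Longrightarrow> f x = g x"
  shows "f x = g x"
proof -
  obtain y z where "y \<in> G 0" "z \<in> G 1" "x = y + z" using G_sum by blast
  then show ?thesis using assms(3) by (simp add: additive.add[OF assms(1)] additive.add[OF assms(2)])
qed

lemma eq_0_if_eq_0_on_G:
  assumes "additive f" "\<And>\<alpha> x. x \<in> G \<alpha> \<Longrightarrow> f x = 0"
  shows "f x = 0"
proof (rule eq_if_eq_on_G[where f = f and g = "\<lambda>_. 0"])
  show "additive (\<lambda>_. 0)" by (simp add: additive_def)
qed (use assms in auto)

text \<open>The difference of \<open>f \<theta>\<close> and \<open>g \<theta>\<close> has degree
  \<theta> and, by \<open>eq\<close>, also degree \<theta> + 1. On homogeneous arguments its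
  coefficients therefore lie in both components, which meet in 0 only.\<close>

lemma Cend_deg_decomposition_unique:
  fixes f g :: "bit \<Rightarrow> 'r \<Rightarrow> 'r poly"
  assumes f: "f 0 \<in> Cend_deg act G 0" "f 1 \<in> Cend_deg act G 1"
    and g: "g 0 \<in> Cend_deg act G 0" "g 1 \<in> Cend_deg act G 1"
    and eq: "(\<lambda>a. f 0 a + f 1 a) = (\<lambda>a. g 0 a + g 1 a)"
  shows "f \<theta> = g \<theta>"
proof -
  have add: "additive h" if "h \<in> Cend_deg act G \<theta>" for h \<theta>
    using that unfolding Cend_deg_def
    by (auto simp: additive_def linear_def module_hom_def module_hom_axioms_def
        module_hom_iff Vector_Spaces.linear_def)
  have eq': "f \<theta> a - g \<theta> a = g (\<theta> + 1) a - f (\<theta> + 1) a" for a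
    using fun_cong[OF eq, of a] by (cases \<theta>) (simp_all add: algebra_simps)
  have mem: "f \<theta> \<in> Cend_deg act G \<theta>" "g \<theta> \<in> Cend_deg act G \<theta>" for \<theta>
    using f g by (cases \<theta>; simp)+
  have disj: "x = 0" if "x \<in> G \<beta>" "x \<in> G (\<beta> + 1)" for x \<beta>
    using that G_disjoint by (cases \<beta>) auto
  have "f \<theta> x = g \<theta> x" if x: "x \<in> G \<alpha>" for \<alpha> x
  proof -
    have deg: "coeff (h x) n \<in> G (\<alpha> + \<beta>)" if "h \<in> Cend_deg act G \<beta>" for h \<beta> n
      using that x unfolding Cend_deg_def polys_in_def by blast
    have "coeff (f \<theta> x - g \<theta> x) n = 0" for n
    proof (rule disj)
      show "coeff (f \<theta> x - g \<theta> x) n \<in> G (\<alpha> + \<theta>)"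
        unfolding coeff_diff by (intro subspace_diff[OF submodule_G] deg mem)
      show "coeff (f \<theta> x - g \<theta> x) n \<in> G (\<alpha> + \<theta> + 1)"
        unfolding eq' coeff_diff add.assoc by (intro subspace_diff[OF submodule_G] deg mem)
    qed
    then have "f \<theta> x - g \<theta> x = 0" by (simp add: poly_eq_iff)
    then show ?thesis by simp
  qed
  then show ?thesis
    using eq_if_eq_on_G[OF add[OF mem(1)] add[OF mem(2)]] by blast
qed

end

section \<open>The bracket at numerical arguments\<close>

context lie_conformal_superalgebra
begin

interpretation V: vector_space "cscale act"
  by (rule vector_space_cscale) unfold_locales

abbreviation B :: "complex \<Rightarrow> 'r \<Rightarrow> 'r \<Rightarrow> 'r" where
  "B z a b \<equiv> ev act z (br a b)"

lemma additive_B_left: "additive (\<lambda>a. B z a b)"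
  and additive_B_right: "additive (B z a)"
  using linear_ev(1)[OF br_linear_left] linear_ev(1)[OF br_linear_right] by auto

lemma B_in_G: "a \<in> G \<alpha> \<Longrightarrow> b \<in> G \<beta> \<Longrightarrow> B z a b \<in> G (\<alpha> + \<beta>)"
  by (intro ev_in_G br_graded)

lemma jacobi_B:
  assumes "a \<in> G \<alpha>" "b \<in> G \<beta>"
  shows "B l a (B m b c) = B (l + m) (B l a b) c + signed (\<alpha> * \<beta>) (B m b (B l a c))"
  using arg_cong[OF C3[OF assms], of "ev2 act l m" c]
  by (simp add: additive.add[OF additive_ev2] additive_signed[OF additive_ev2]
      ev2_subst_linear[OF br_linear_right] ev2_subst_linear[OF br_linear_left])

text \<open>Inside \<open>[\<cdot>\<^sub>k d]\<close> the operator \<open>\<partial>\<close> is the number \<open>-k\<close>, so that \<open>-\<partial> - z\<close> becomes \<open>k - z\<close>.\<close>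

lemma skew_B:
  assumes "a \<in> G \<alpha>" "b \<in> G \<beta>"
  shows "B k (B z a b) d = - signed (\<alpha> * \<beta>) (B k (B (k - z) b a) d)"
proof -
  define \<phi> where "\<phi> p = B k (ev act z p) d" for p
  have \<phi>: "additive \<phi>"
    unfolding \<phi>_def additive_def
    by (simp add: additive.add[OF additive_ev] additive.add[OF additive_B_left])
  have partial: "B k (partial act x) d = - cscale act k (B k x d)" for x
    by (simp add: C1 additive.minus[OF additive_ev] ev_pCons)
  have "\<phi> (neg_partial_lam act p) = cscale act (k - z) (\<phi> p)" for p
    unfolding \<phi>_def neg_partial_lam_def
    by (simp add: additive.diff[OF additive_ev] additive.minus[OF additive_ev] ev_pCons ev_partial
        additive.diff[OF additive_B_left] additive.minus[OF additive_B_left] partial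
        linear_ev(2)[OF br_linear_left] V.scale_left_diff_distrib)
  \<comment> \<open>Applying \<open>\<phi>\<close> turns the substitution in \<open>C2\<close> into
    evaluation of \<open>br b a\<close> at \<open>k - z\<close>.\<close>
  from additive_apply_subst[where T = "neg_partial_lam act" and T' = "cscale act (k - z)"
      and e = "\<lambda>x. [:x:]" and p = "br b a", OF \<phi> this]
  have "\<phi> (subst (neg_partial_lam act) (\<lambda>x. [:x:]) (br b a)) = B k (B (k - z) b a) d"
    by (simp add: \<phi>_def ev_const linear_ev_ev[where f = "\<lambda>x. br x d", OF br_linear_left])
  moreover have "\<phi> (br a b)
      = - signed (\<alpha> * \<beta>) (\<phi> (subst (neg_partial_lam act) (\<lambda>x. [:x:]) (br b a)))"
    by (subst C2[OF assms]) (simp add: additive.minus[OF \<phi>] additive_signed[OF \<phi>])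
  ultimately show ?thesis by (simp add: \<phi>_def)
qed

text \<open>This makes the trivial center usable with numbers: an equation may be checked after
  bracketing with a further element.\<close>

lemma eq_0_if_B_eq_0:
  assumes "center br = {0}" "\<And>z b. B z a b = 0"
  shows "a = 0"
proof -
  have "br a b = 0" for b
    by (rule poly_eqI_ev) (simp add: assms(2) additive.zero[OF additive_ev])
  then show ?thesis using assms(1) unfolding center_def by blast
qed

lemma Cend_degD:
  assumes "f \<in> Cend_deg act G \<theta>"
  shows "Vector_Spaces.linear (cscale act) (pscale act) f"
    and "a \<in> G \<alpha> \<Longrightarrow> ev act z (f a) \<in> G (\<alpha> + \<theta>)"
    and "additive (\<lambda>x. ev act z (f x))"
proof -
  show lin: "Vector_Spaces.linear (cscale act) (pscale act) f"
    using assms unfolding Cend_deg_def by blast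
  show "a \<in> G \<alpha> \<Longrightarrow> ev act z (f a) \<in> G (\<alpha> + \<theta>)"
    using assms unfolding Cend_deg_def by (blast intro: ev_in_G)
  show "additive (\<lambda>x. ev act z (f x))" by (rule linear_ev[OF lin])
qed

lemma ev2_br:
  assumes "f \<in> Cend_deg act G \<theta>"
  shows "ev2 act l m (br_left br f a b) = B (l + m) (ev act l (f a)) b"
    and "ev2 act l m (br_right br f a b) = B m a (ev act l (f b))"
    and "ev2 act l m (of_br br f a b) = ev act l (f (B m a b))"
  unfolding br_left_def br_right_def of_br_def
  by (rule ev2_subst_linear[OF br_linear_left] ev2_subst_linear[OF br_linear_right]
      ev2_subst_linear[OF Cend_degD(1)[OF assms]])+

text \<open>\<open>F\<close> and \<open>F'\<close> abstract the values of f and of half its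
  companion f'. Both assumptions \<open>left\<close> and \<open>right\<close> let \<open>F'\<close>
  of a bracket be traded for \<open>F\<close> on either factor.\<close>

lemma quasicentroid_eq_on_brackets:
  assumes center: "center br = {0}"
    and F: "\<And>z. additive (F z)" "\<And>z a \<alpha>. a \<in> G \<alpha> \<Longrightarrow> F z a \<in> G (\<alpha> + \<theta>)"
    and F': "\<And>z. additive (F' z)" "\<And>z a \<alpha>. a \<in> G \<alpha> \<Longrightarrow> F' z a \<in> G (\<alpha> + \<theta>)"
    and left: "\<And>l m a b. B (l + m) (F l a) b = F' l (B m a b)"
    and right: "\<And>l m a b \<alpha>. a \<in> G \<alpha> \<Longrightarrow> signed (\<theta> * \<alpha>) (B m a (F l b)) = F' l (B m a b)"
  shows "F' l (B m a b) = F l (B m a b)"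
proof -
  define H where "H z x = F' z x - F z x" for z x
  have H: "H z a \<in> G (\<alpha> + \<theta>)" if "a \<in> G \<alpha>" for z a \<alpha>
    unfolding H_def using that by (intro subspace_diff[OF submodule_G] F(2) F'(2))
  have right': "B m a (F l b) = signed (\<theta> * \<alpha>) (F' l (B m a b))" if "a \<in> G \<alpha>" for l m a b \<alpha>
    unfolding right[OF that, symmetric] by (cases \<theta>; cases \<alpha>) simp_all
  note signed_simps = signed_add additive_signed[OF additive_B_left]
    additive_signed[OF additive_B_right] additive_signed[OF F(1)] additive_signed[OF F'(1)]
  \<comment> \<open>The Jacobi identity is used twice, for a, \<open>F l b\<close>, c and, after
    applying \<open>F' l\<close>, for a, b, c. Eliminating the common term with [b, [a, c]] leaves
    only the difference \<open>H\<close>.\<close>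
  have comm: "B m a (H l (B n b c)) = signed (\<theta> * \<alpha>) (B (l + m + n) (H l (B m a b)) c)"
    if a: "a \<in> G \<alpha>" and b: "b \<in> G \<beta>" for a b c l m n \<alpha> \<beta>
  proof -
    have "B m a (F' l (B n b c)) = B m a (B (l + n) (F l b) c)"
      by (simp add: left)
    also have "\<dots> = B (l + m + n) (B m a (F l b)) c
        + signed (\<alpha> * (\<beta> + \<theta>)) (B (l + n) (F l b) (B m a c))"
      using jacobi_B[OF a F(2)[OF b], of m "l + n" l c] by (simp add: add_ac)
    also have "\<dots> = signed (\<theta> * \<alpha>) (B (l + m + n) (F' l (B m a b)) c)
        + signed (\<alpha> * \<theta>) (signed (\<alpha> * \<beta>) (F' l (B n b (B m a c))))"
      by (simp add: left right'[OF a] signed_simps distrib_left add_ac)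
    finally have 1: "B m a (F' l (B n b c)) = signed (\<theta> * \<alpha>) (B (l + m + n) (F' l (B m a b)) c)
        + signed (\<alpha> * \<theta>) (signed (\<alpha> * \<beta>) (F' l (B n b (B m a c))))" .
    have "signed (\<alpha> * \<beta>) (F' l (B n b (B m a c))) = F' l (B m a (B n b c)) - F' l (B (m + n) (B m a b) c)"
      using arg_cong[OF jacobi_B[OF a b, of m n c], of "F' l"]
      by (simp add: additive.add[OF F'(1)] signed_simps)
    also have "\<dots> = signed (\<theta> * \<alpha>) (B m a (F l (B n b c))) - B (l + m + n) (F l (B m a b)) c"
      by (simp add: right[OF a] left add.assoc)
    finally have 2: "signed (\<alpha> * \<beta>) (F' l (B n b (B m a c))) = \<dots>" .
    show ?thesis
      using 1 unfolding 2 H_def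
      by (cases \<theta>; cases \<alpha>) (simp_all add: additive.diff[OF additive_B_left] signed_def
          additive.diff[OF additive_B_right] algebra_simps)
  qed
  \<comment> \<open>The numbers \<open>m\<close>, \<open>n\<close>, \<open>r\<close> belong to \<open>a\<close>, \<open>b\<close>, \<open>c\<close> and rotate with them.\<close>
  define S where "S m n r a b c l d = B (l + m + n + r) (B m a (H l (B n b c))) d" for m n r a b c l d
  \<comment> \<open>The outer number \<open>l + m + n + r\<close> is chosen so that skew-symmetry
    replaces the inner \<open>l + m + n\<close> by \<open>r\<close>, the number of c.\<close>
  have rotate: "S m n r a b c l d = - signed (\<theta> * \<alpha> + \<gamma> * (\<alpha> + \<beta> + \<theta>)) (S r m n c a b l d)"
    if a: "a \<in> G \<alpha>" and b: "b \<in> G \<beta>" and c: "c \<in> G \<gamma>" for m n r a b c l d \<alpha> \<beta> \<gamma>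
  proof -
    have "S m n r a b c l d
        = signed (\<theta> * \<alpha>) (B (l + m + n + r) (B (l + m + n) (H l (B m a b)) c) d)"
      unfolding S_def comm[OF a b] by (simp add: signed_simps)
    also have "B (l + m + n + r) (B (l + m + n) (H l (B m a b)) c) d
        = - signed ((\<alpha> + \<beta> + \<theta>) * \<gamma>) (B (l + m + n + r) (B r c (H l (B m a b))) d)"
      unfolding skew_B[OF H[OF B_in_G[OF a b]] c] by simp
    finally show ?thesis
      by (simp add: S_def signed_minus mult.commute add_ac)
  qed
  have S0: "S m n r a b c l d = 0"
    if a: "a \<in> G \<alpha>" and b: "b \<in> G \<beta>" and c: "c \<in> G \<gamma>" for m n r a b c l d \<alpha> \<beta> \<gamma>
  proof -
    \<comment> \<open>Each product of two degrees occurs twice in the three sign exponents together,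
      so only the three minus signs survive.\<close>
    have "S m n r a b c l d = - S m n r a b c l d"
      by (subst rotate[OF a b c], subst rotate[OF c a b], subst rotate[OF b c a])
        (cases \<theta>; cases \<alpha>; cases \<beta>; cases \<gamma>; simp add: signed_def)
    then have "S m n r a b c l d + S m n r a b c l d = 0"
      by (simp only: eq_neg_iff_add_eq_0)
    \<comment> \<open>An abelian group may have 2-torsion; cancelling 2 relies on its being an
      invertible scalar.\<close>
    then have "cscale act 2 (S m n r a b c l d) = 0"
      using V.scale_left_distrib[of 1 1 "S m n r a b c l d"] by simp
    then show ?thesis by (simp only: V.scale_eq_0_iff) simp
  qed
  have 0: "B m a (H l (B n b c)) = 0"
    if a: "a \<in> G \<alpha>" and b: "b \<in> G \<beta>" and c: "c \<in> G \<gamma>" for m n a b c l \<alpha> \<beta> \<gamma>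
  proof (rule eq_0_if_B_eq_0[OF center])
    fix k d
    show "B k (B m a (H l (B n b c))) d = 0"
      using S0[OF a b c, of m n "k - l - m - n" l d] by (simp add: S_def)
  qed
  have add_HB: "additive (\<lambda>x. H l (B m a x))" "additive (\<lambda>x. H l (B m x b))" for l m a b
    by (simp_all add: additive_def H_def additive.add[OF additive_B_left]
        additive.add[OF additive_B_right] additive.add[OF F(1)] additive.add[OF F'(1)])
  have "H l (B m a b) = 0" if a: "a \<in> G \<alpha>" and b: "b \<in> G \<beta>" for a b l m \<alpha> \<beta>
  proof (rule eq_0_if_B_eq_0[OF center])
    fix z d
    \<comment> \<open>By \<open>comm\<close>, the vanishing of [a, H[b, c]] passes to [H[a, b], c];
      the choice \<open>z - l - m\<close> makes the outer number an arbitrary z.\<close>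
    have "B (l + m + (z - l - m)) (H l (B m a b)) c = 0" if c: "c \<in> G \<gamma>" for c \<gamma>
      using comm[OF a b, of m l "z - l - m" c] 0[OF a b c, of m l "z - l - m"]
      by (auto simp: signed_def split: if_splits)
    then have "B z (H l (B m a b)) c = 0" if c: "c \<in> G \<gamma>" for c \<gamma>
      using c by simp
    then show "B z (H l (B m a b)) d = 0"
      by (rule eq_0_if_eq_0_on_G[OF additive_B_right])
  qed
  then have "H l (B m a b) = 0" if "a \<in> G \<alpha>" for a b \<alpha>
    using that eq_0_if_eq_0_on_G[OF add_HB(1)] by blast
  then have "H l (B m a b) = 0"
    using eq_0_if_eq_0_on_G[OF add_HB(2)] by blast
  then show ?thesis by (simp add: H_def)
qed

section \<open>The two inclusions in a fixed degree\<close>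

lemma QC_deg_inter_QDer_deg:
  assumes center: "center br = {0}"
    and QC: "f \<in> QC_deg act G br \<theta>" and QDer: "f \<in> QDer_deg act G br \<theta>"
  shows "f \<in> C_deg act G br \<theta>"
proof -
  have f: "f \<in> Cend_deg act G \<theta>"
    and qc: "\<And>\<alpha> a b. a \<in> G \<alpha> \<Longrightarrow> br_left br f a b = signed (\<theta> * \<alpha>) (br_right br f a b)"
    using QC unfolding QC_deg_def by auto
  obtain f' where f': "f' \<in> Cend_deg act G \<theta>"
    and qd: "\<And>\<alpha> a b. a \<in> G \<alpha> \<Longrightarrow>
      br_left br f a b + signed (\<theta> * \<alpha>) (br_right br f a b) = of_br br f' a b"
    using QDer unfolding QDer_deg_def by auto
  define F where "F z x = ev act z (f x)" for z x
  \<comment> \<open>The quasicentroid identity makes the two terms of the quasiderivation identity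
    equal, so f' on a bracket is twice either of them.\<close>
  define F' where "F' z x = cscale act (1 / 2) (ev act z (f' x))" for z x
  have F: "additive (F z)" "a \<in> G \<alpha> \<Longrightarrow> F z a \<in> G (\<alpha> + \<theta>)" for z a \<alpha>
    using Cend_degD(2,3)[OF f] unfolding F_def by auto
  have F': "additive (F' z)" "a \<in> G \<alpha> \<Longrightarrow> F' z a \<in> G (\<alpha> + \<theta>)" for z a \<alpha>
    using Cend_degD(2,3)[OF f'] cscale_in_G unfolding F'_def
    by (auto simp: additive_def V.scale_right_distrib)
  have right: "signed (\<theta> * \<alpha>) (B m a (F l b)) = B (l + m) (F l a) b" if "a \<in> G \<alpha>" for l m a b \<alpha>
    using arg_cong[OF qc[OF that], of "ev2 act l m"]
    by (simp add: ev2_br[OF f] F_def additive_signed[OF additive_ev2])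
  have left: "B (l + m) (F l a) b = F' l (B m a b)" for l m a b
  \<comment> \<open>The claim carries no sign and is additive in a, so homogeneous a
    suffice.\<close>
  proof (rule eq_if_eq_on_G[where x = a])
    show "additive (\<lambda>a. B (l + m) (F l a) b)" "additive (\<lambda>a. F' l (B m a b))"
      by (simp_all add: additive_def additive.add[OF F(1)] additive.add[OF F'(1)]
          additive.add[OF additive_B_left])
    fix \<alpha> a assume a: "a \<in> G \<alpha>"
    have "ev act l (f' (B m a b)) = B (l + m) (F l a) b + signed (\<theta> * \<alpha>) (B m a (F l b))"
      using arg_cong[OF qd[OF a], of "ev2 act l m"]
      by (simp add: ev2_br[OF f] ev2_br[OF f'] F_def additive_signed[OF additive_ev2]
          additive.add[OF additive_ev2])
    also have "\<dots> = cscale act 2 (B (l + m) (F l a) b)"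
      using V.scale_left_distrib[of 1 1 "B (l + m) (F l a) b"] right[OF a] by simp
    finally show "B (l + m) (F l a) b = F' l (B m a b)" by (simp add: F'_def)
  qed
  have eq: "F' l (B m a b) = F l (B m a b)" for l m a b
    using quasicentroid_eq_on_brackets[OF center, of F \<theta> F'] F F' left right by simp
  have "br_left br f a b = of_br br f a b" for a b
    by (rule poly_poly_eqI_ev2) (simp add: ev2_br[OF f] F_def[symmetric] left eq)
  with f qc show ?thesis unfolding C_deg_def by auto
qed

lemma C_deg_subset_QC_deg: "C_deg act G br \<theta> \<subseteq> QC_deg act G br \<theta>"
  unfolding C_deg_def QC_deg_def by auto

text \<open>For f in the centroid both terms of the quasiderivation identity equal f on the bracket,
  so 2f serves as companion.\<close>

lemma C_deg_subset_QDer_deg: "C_deg act G br \<theta> \<subseteq> QDer_deg act G br \<theta>"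
proof
  fix f assume "f \<in> C_deg act G br \<theta>"
  then have f: "f \<in> Cend_deg act G \<theta>"
    and C: "\<And>\<alpha> a b. a \<in> G \<alpha> \<Longrightarrow> br_left br f a b = of_br br f a b"
      "\<And>\<alpha> a b. a \<in> G \<alpha> \<Longrightarrow> signed (\<theta> * \<alpha>) (br_right br f a b) = of_br br f a b"
    unfolding C_deg_def by auto
  define g where "g a = f a + f a" for a
  interpret VP: vector_space_pair "cscale act" "pscale act"
    by (intro vector_space_pair.intro vector_space_cscale vector_space_pscale) unfold_locales
  have "Vector_Spaces.linear (cscale act) (pscale act) g"
    unfolding g_def by (intro VP.linear_compose_add Cend_degD(1)[OF f])
  moreover have "g (partial act a) = map_poly (partial act) (g a) + pCons 0 (g a)" for a
    using f unfolding Cend_deg_def g_def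
    by (simp add: poly_eq_iff coeff_map_poly additive.zero[OF additive_partial]
        additive.add[OF additive_partial] coeff_pCons split: nat.split)
  moreover have "g a \<in> polys_in (G (\<alpha> + \<theta>))" if "a \<in> G \<alpha>" for a \<alpha>
    using f that unfolding Cend_deg_def g_def polys_in_def
    by (auto intro!: subspace_add[OF submodule_G])
  ultimately have g: "g \<in> Cend_deg act G \<theta>" unfolding Cend_deg_def by auto
  have "of_br br f a b + of_br br f a b = of_br br g a b" for a b
    by (rule poly_poly_eqI_ev2)
      (simp add: additive.add[OF additive_ev2] ev2_br[OF f] ev2_br[OF g] g_def additive.add[OF additive_ev])
  with C f g show "f \<in> QDer_deg act G br \<theta>" unfolding QDer_deg_def by auto
qed

end

theorem theorem4p8:
  fixes act :: "complex poly \<Rightarrow> 'r::ab_group_add \<Rightarrow> 'r"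
    and G :: "bit \<Rightarrow> 'r set"
    and br :: "'r \<Rightarrow> 'r \<Rightarrow> 'r poly"
  assumes "lie_conformal_superalgebra act G br"
    and "center br = {0}"
  shows "QC act G br \<inter> QDer act G br = Centroid act G br"
proof -
  interpret lie_conformal_superalgebra act G br by fact
  show ?thesis
  proof (intro equalityI subsetI)
    fix h assume "h \<in> QC act G br \<inter> QDer act G br"
    then obtain f0 f1 g0 g1 where h: "h = (\<lambda>a. f0 a + f1 a)" "h = (\<lambda>a. g0 a + g1 a)"
      and f: "f0 \<in> QC_deg act G br 0" "f1 \<in> QC_deg act G br 1"
      and g: "g0 \<in> QDer_deg act G br 0" "g1 \<in> QDer_deg act G br 1"
      unfolding QC_def QDer_def graded_sum_def by blast
    \<comment> \<open>The splittings of \<open>h\<close> in \<open>QC\<close> and in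
      \<open>QDer\<close> are chosen independently; indexed by degree, they are identified by
      uniqueness.\<close>
    define f' g' where "f' = (\<lambda>\<theta>::bit. if \<theta> = 0 then f0 else f1)"
      and "g' = (\<lambda>\<theta>::bit. if \<theta> = 0 then g0 else g1)"
    have "f' \<theta> = g' \<theta>" for \<theta>
      by (rule Cend_deg_decomposition_unique)
        (use f g h in \<open>auto simp: f'_def g'_def QC_deg_def QDer_deg_def\<close>)
    from this[of 0] this[of 1] have "f0 = g0" "f1 = g1" by (simp_all add: f'_def g'_def)
    with f g have "f0 \<in> C_deg act G br 0" "f1 \<in> C_deg act G br 1"
      by (auto intro: QC_deg_inter_QDer_deg[OF assms(2)])
    with h(1) show "h \<in> Centroid act G br" unfolding Centroid_def graded_sum_def by blast
  next
    fix h assume "h \<in> Centroid act G br"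
    then show "h \<in> QC act G br \<inter> QDer act G br"
      using C_deg_subset_QC_deg C_deg_subset_QDer_deg
      unfolding Centroid_def QC_def QDer_def graded_sum_def by blast
  qed
qed

end
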